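(* Let $N\ge2$ and $d\ge1$ be integers. Let $E\subset\mathbb{Z}_N^d$, with indicator function $E:\mathbb{Z}_N^d\to\mathbb{C}$, and let $S\subset\mathbb{Z}_N^d$ be such that the frequencies $\{\widehat E(m)\}_{m\in S}$ are lost. If $$|S|\,\Lambda^{\frac13}(E)<\frac{N^d}{2^{\frac43}},$$ then the indicator function $E$ is recoverable by the Direct Recovery Algorithm; that is, for every $x\in\mathbb{Z}_N^d$, rounding $|I(x)|$ to the nearest element of $\{0,1\}$ gives exactly $E(x)$, where $I(x)=\sum_{m\notin S}\chi(x\cdot m)\widehat E(m)$.
   Context: $\mathbb{Z}_N=\mathbb{Z}/N\mathbb{Z}$, and $\chi(t)=e^{2\pi i t/N}$ for $t\in\mathbb{Z}_N$. The indicator function of a set $E$ is denoted by the same letter: $E(x)=1$ if $x\in E$ and $E(x)=0$ otherwise. The discrete Fourier transform of $f:\mathbb{Z}_N^d\to\mathbb{C}$ is $\widehat f(m)=N^{-d}\sum_{x\in\mathbb{Z}_N^d}\chi(-x\cdot m)f(x)$. For $A\subset\mathbb{Z}_N^d$, the additive energy is $\Lambda(A)=|\{(x_1,x_2,x_3,x_4)\in A^4: x_1+x_2=x_3+x_4\}|$. The Direct Recovery Algorithm for a binary signal with frequencies in $S$ missing: compute $I(x)=\sum_{m\notin S}\chi(x\cdot m)\widehat E(m)$ from the observed frequencies, take $|I(x)|$, and round it to $0$ or $1$, whichever is nearest. *)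

theory Defs
  imports Complex_Main "HOL-Library.FuncSet" "HOL-Library.Indicator_Function" "HOL-Number_Theory.Cong"
begin

text \<open>
  Elements of \<open>\<int>\<^sub>N\<close> are represented by their residues in \<open>{0..<N}\<close>, and vectors by
  extensional functions on the coordinates \<open>{..<d}\<close>.  Equalities in \<open>\<int>\<^sub>N\<close> become
  coordinatewise congruences modulo \<open>N\<close>.
\<close>

definition ZN_vec :: "nat \<Rightarrow> nat \<Rightarrow> (nat \<Rightarrow> int) set" where
  "ZN_vec N d = {..<d} \<rightarrow>\<^sub>E {0..<int N}"

text \<open>
  Since \<open>\<chi>\<close> is \<open>N\<close>-periodic in its integer argument, neither its argument nor the dot
  product is reduced modulo \<open>N\<close>.
\<close>

definition chi :: "nat \<Rightarrow> int \<Rightarrow> complex" where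
  "chi N t = exp (2 * of_real pi * \<i> * of_int t / of_nat N)"

definition dot :: "nat \<Rightarrow> (nat \<Rightarrow> int) \<Rightarrow> (nat \<Rightarrow> int) \<Rightarrow> int" where
  "dot d x m = (\<Sum>i<d. x i * m i)"

definition dft :: "nat \<Rightarrow> nat \<Rightarrow> ((nat \<Rightarrow> int) \<Rightarrow> complex) \<Rightarrow> (nat \<Rightarrow> int) \<Rightarrow> complex" where
  "dft N d f m = (\<Sum>x\<in>ZN_vec N d. chi N (- dot d x m) * f x) / of_nat (N ^ d)"

definition additive_energy :: "nat \<Rightarrow> nat \<Rightarrow> (nat \<Rightarrow> int) set \<Rightarrow> nat" where
  "additive_energy N d A =
     card {(x1, x2, x3, x4). x1 \<in> A \<and> x2 \<in> A \<and> x3 \<in> A \<and> x4 \<in> A \<and>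
             (\<forall>i<d. [x1 i + x2 i = x3 i + x4 i] (mod int N))}"

text \<open>
  The recovery sum takes a family of Fourier coefficients \<open>F\<close>, but reads it only at the
  observed frequencies, those outside \<open>S\<close>.
\<close>

definition recovery_sum ::
  "nat \<Rightarrow> nat \<Rightarrow> (nat \<Rightarrow> int) set \<Rightarrow> ((nat \<Rightarrow> int) \<Rightarrow> complex) \<Rightarrow> (nat \<Rightarrow> int) \<Rightarrow> complex" where
  "recovery_sum N d S F x = (\<Sum>m\<in>ZN_vec N d - S. chi N (dot d x m) * F m)"

text \<open>
  Rounding is a relation, so that no convention is needed for the tie \<open>t = 1/2\<close>: there,
  \<open>t\<close> rounds to neither value, and recovery fails.
\<close>

definition rounds_to :: "real \<Rightarrow> real \<Rightarrow> bool" where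
  "rounds_to t b \<longleftrightarrow> b \<in> {0, 1} \<and> (\<forall>c\<in>{0, 1}. c \<noteq> b \<longrightarrow> \<bar>t - b\<bar> < \<bar>t - c\<bar>)"

definition direct_recoverable ::
  "nat \<Rightarrow> nat \<Rightarrow> (nat \<Rightarrow> int) set \<Rightarrow> (nat \<Rightarrow> int) set \<Rightarrow> bool" where
  "direct_recoverable N d S E \<longleftrightarrow>
     (\<forall>x\<in>ZN_vec N d.
        rounds_to (cmod (recovery_sum N d S (dft N d (indicator E)) x)) (indicator E x))"

end

theory Submission
  imports Defs "HOL-Analysis.Complex_Transcendental"
begin

text \<open>
  By Fourier inversion \<open>E(x) - I(x)\<close> is the sum of \<open>\<chi>(x \<cdot> m) E^(m)\<close> over \<open>m \<in> S\<close>.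
  Hoelder's inequality bounds the fourth power of its modulus by \<open>|S|\<^sup>3\<close> times the fourth
  moment of the Fourier transform, and the latter equals \<open>N\<^bsup>-3d\<^esup> \<Lambda>(E)\<close>.  The hypothesis then
  says precisely that this bound is below \<open>(1/2)\<^sup>4\<close>, so rounding is correct.
\<close>

lemma chi_0 [simp]: "chi N 0 = 1"
  by (simp add: chi_def)

lemma chi_add: "chi N (a + b) = chi N a * chi N b"
  by (simp add: chi_def add_divide_distrib distrib_left exp_add)

lemma chi_minus: "chi N (- a) = cnj (chi N a)"
  by (simp add: chi_def exp_cnj)

lemma chi_diff: "chi N (a - b) = chi N a * cnj (chi N b)"
  using chi_add[of N a "- b"] by (simp add: chi_minus)

lemma norm_chi [simp]: "norm (chi N a) = 1"
proof -
  have "chi N a = exp (\<i> * of_real (2 * pi * of_int a / of_nat N))"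
    by (simp add: chi_def mult_ac)
  then show ?thesis by (metis norm_exp_i_times)
qed

lemma chi_sum: "chi N (\<Sum>i\<in>A. f i) = (\<Prod>i\<in>A. chi N (f i))"
  by (induction A rule: infinite_finite_induct) (simp_all add: chi_add)

lemma chi_mult_nat: "chi N (a * int k) = chi N a ^ k"
  by (induction k) (simp_all add: chi_add distrib_left mult.commute)

lemma chi_eq_1_iff:
  assumes "N > 0"
  shows "chi N a = 1 \<longleftrightarrow> int N dvd a"
proof -
  have "chi N a = 1 \<longleftrightarrow> (\<exists>n::int. 2 * pi * of_int a / real N = of_int (2 * n) * pi)"
    by (simp add: chi_def exp_eq_1 flip: of_int_mult)
  also have "\<dots> \<longleftrightarrow> (\<exists>n::int. of_int a = real_of_int (int N * n))"
    using assms by (simp add: field_simps)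
  also have "\<dots> \<longleftrightarrow> int N dvd a"
    unfolding of_int_eq_iff dvd_def by simp
  finally show ?thesis .
qed

text \<open>The ratio \<open>chi N a\<close> is an \<open>N\<close>-th root of unity, so this
  geometric sum vanishes unless the ratio is 1, which happens exactly when \<open>N\<close> divides
  \<open>a\<close>.\<close>

lemma sum_chi:
  assumes "N > 0"
  shows "(\<Sum>k\<in>{0..<int N}. chi N (a * k)) = (if int N dvd a then of_nat N else 0)"
proof -
  have "(\<Sum>k\<in>{0..<int N}. chi N (a * k)) = (\<Sum>k<N. chi N a ^ k)"
    by (rule sum.reindex_bij_witness[of _ int nat]) (auto simp: chi_mult_nat[symmetric])
  moreover have "chi N a ^ N = 1"
    using chi_eq_1_iff[OF assms, of "a * int N"] by (simp add: chi_mult_nat)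
  ultimately show ?thesis
    using chi_eq_1_iff[OF assms, of a] by (cases "chi N a = 1") (simp_all add: geometric_sum)
qed

lemma finite_ZN_vec [simp]: "finite (ZN_vec N d)"
  by (simp add: ZN_vec_def finite_PiE)

text \<open>A character of a dot product splits over coordinates, so the sum is a product of
  one-dimensional sums. Here \<open>x\<close> is an arbitrary integer vector: the lemma is applied
  to differences, which leave the box of residues.\<close>

lemma chi_orthogonality:
  assumes "N > 0"
  shows "(\<Sum>m\<in>ZN_vec N d. chi N (dot d x m))
       = (if \<forall>i<d. int N dvd x i then of_nat (N ^ d) else 0)"
proof -
  have "(\<Sum>m\<in>ZN_vec N d. chi N (dot d x m))
      = (\<Prod>i<d. \<Sum>k\<in>{0..<int N}. chi N (x i * k))"
    by (simp add: dot_def chi_sum ZN_vec_def prod_sum_PiE)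
  also have "\<dots> = (\<Prod>i<d. if int N dvd x i then of_nat N else 0)"
    by (simp add: sum_chi[OF assms])
  also have "\<dots> = (if \<forall>i<d. int N dvd x i then of_nat (N ^ d) else 0)"
    by auto
  finally show ?thesis .
qed

lemma dot_diff: "dot d (\<lambda>i. x i - y i) m = dot d x m - dot d y m"
  by (simp add: dot_def sum_subtractf left_diff_distrib)

lemma dot_add: "dot d (\<lambda>i. x i + y i) m = dot d x m + dot d y m"
  by (simp add: dot_def sum.distrib distrib_right)

text \<open>Turns the congruences delivered by orthogonality into equality of vectors: residues are
  unique below \<open>d\<close>, and extensionality fixes the values elsewhere.\<close>

lemma ZN_vec_eqI:
  assumes "x \<in> ZN_vec N d" "y \<in> ZN_vec N d" "\<forall>i<d. int N dvd x i - y i"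
  shows "x = y"
proof
  fix i
  show "x i = y i"
  proof (cases "i < d")
    case True
    then have "x i \<in> {0..<int N}" "y i \<in> {0..<int N}"
      using assms(1,2) unfolding ZN_vec_def by (blast intro: PiE_mem)+
    moreover have "x i mod int N = y i mod int N"
      using assms(3) True by (simp add: mod_eq_dvd_iff)
    ultimately show ?thesis by simp
  next
    case False
    then show ?thesis using assms(1,2) unfolding ZN_vec_def by (metis PiE_arb lessThan_iff)
  qed
qed

lemma fourier_inversion:
  assumes "N > 0" "x \<in> ZN_vec N d"
  shows "(\<Sum>m\<in>ZN_vec N d. chi N (dot d x m) * dft N d f m) = f x"
proof -
  have "(\<Sum>m\<in>ZN_vec N d. chi N (dot d x m) * dft N d f m)
      = (\<Sum>m\<in>ZN_vec N d. \<Sum>y\<in>ZN_vec N d. f y * chi N (dot d (\<lambda>i. x i - y i) m))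
        / of_nat (N ^ d)"
    by (simp add: dft_def sum_divide_distrib sum_distrib_left dot_diff chi_diff chi_minus mult_ac)
  also have "\<dots> = (\<Sum>y\<in>ZN_vec N d. f y * (\<Sum>m\<in>ZN_vec N d. chi N (dot d (\<lambda>i. x i - y i) m)))
        / of_nat (N ^ d)"
    by (subst sum.swap) (simp add: sum_distrib_left)
  also have "\<dots> = (\<Sum>y\<in>ZN_vec N d. if x = y then f y * of_nat (N ^ d) else 0) / of_nat (N ^ d)"
    unfolding chi_orthogonality[OF assms(1)]
    by (intro arg_cong2[where f = "(/)"] sum.cong refl) (auto intro: ZN_vec_eqI[OF assms(2)])
  also have "\<dots> = f x"
    using assms by simp
  finally show ?thesis .
qed

text \<open>Expanding the fourth power gives a character sum over quadruples from \<open>E\<close>,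
  and summing over \<open>m\<close> keeps those with x1 + x2 = x3 + x4. Each contributes
  \<open>N ^ d\<close>, against the fourth power of \<open>N ^ d\<close> from the
  normalisation.\<close>

lemma sum_norm_dft_indicator_pow4:
  assumes "N > 0" "E \<subseteq> ZN_vec N d"
  shows "(\<Sum>m\<in>ZN_vec N d. cmod (dft N d (indicator E) m) ^ 4)
       = real (additive_energy N d E) / real (N ^ d) ^ 3"
proof -
  have fin: "finite E" using assms(2) by (rule finite_subset) simp
  \<comment> \<open>The unnormalised transform with the opposite sign; conjugation does not change
    the modulus.\<close>
  define g where "g = (\<lambda>m. \<Sum>x\<in>E. chi N (dot d x m))"
  define D where "D = (\<lambda>(x1, x2, x3, x4). \<lambda>i::nat. (x1 i + x2 i) - (x3 i + x4 i) :: int)"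
  define Q where "Q = E \<times> E \<times> E \<times> E"
  have dft: "dft N d (indicator E) m = cnj (g m) / of_nat (N ^ d)" for m
    using assms(2)
    by (simp add: dft_def g_def chi_minus indicator_def if_distrib sum.If_cases Int_absorb1
        cong: if_cong)
  have "cmod (g m) ^ 4 = (\<Sum>q\<in>Q. chi N (dot d (D q) m))" for m
  proof -
    have "of_real (cmod (g m) ^ 4) = (g m * cnj (g m))\<^sup>2"
      by (simp add: complex_norm_square[symmetric] flip: power_mult)
    \<comment> \<open>The bracketing matches the right-nested product \<open>Q\<close>, with the
      conjugated factors supplying x3 and x4.\<close>
    also have "\<dots> = g m * (g m * (cnj (g m) * cnj (g m)))"
      by (simp add: power2_eq_square)
    also have "\<dots> = (\<Sum>q\<in>Q. chi N (dot d (D q) m))"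
      by (simp add: g_def Q_def D_def sum_product sum.cartesian_product case_prod_unfold chi_add
          chi_diff dot_add dot_diff mult_ac)
    finally show ?thesis .
  qed
  then have "complex_of_real (\<Sum>m\<in>ZN_vec N d. cmod (g m) ^ 4)
      = (\<Sum>q\<in>Q. \<Sum>m\<in>ZN_vec N d. chi N (dot d (D q) m))"
    by (simp add: sum.swap[of _ "ZN_vec N d"])
  also have "\<dots> = (\<Sum>q\<in>Q. if \<forall>i<d. int N dvd D q i then of_nat (N ^ d) else 0)"
    unfolding chi_orthogonality[OF assms(1)] ..
  also have "\<dots> = of_nat (card {q \<in> Q. \<forall>i<d. int N dvd D q i}) * of_nat (N ^ d)"
    using fin by (simp add: sum.If_cases Q_def Int_def)
  also have "{q \<in> Q. \<forall>i<d. int N dvd D q i} = {(x1, x2, x3, x4). x1 \<in> E \<and> x2 \<in> E \<and> x3 \<in> E \<and> x4 \<in> E \<and>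
             (\<forall>i<d. [x1 i + x2 i = x3 i + x4 i] (mod int N))}"
    by (auto simp: Q_def D_def cong_iff_dvd_diff)
  also have "of_nat (card \<dots>) * of_nat (N ^ d)
      = complex_of_real (real (additive_energy N d E) * real (N ^ d))"
    by (simp add: additive_energy_def)
  finally have "(\<Sum>m\<in>ZN_vec N d. cmod (g m) ^ 4) = real (additive_energy N d E) * real (N ^ d)"
    unfolding of_real_eq_iff .
  then show ?thesis
    using assms(1)
    by (simp add: dft norm_divide power_divide norm_power power4_eq_xxxx power3_eq_cube
        flip: sum_divide_distrib)
qed

text \<open>Hoelder's inequality with exponents 4 and 4/3 against the constant 1, obtained from two
  applications of Cauchy-Schwarz.\<close>

lemma sum_pow4_le_card_pow3:
  fixes a :: "'a \<Rightarrow> real"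
  shows "(\<Sum>x\<in>A. a x) ^ 4 \<le> real (card A) ^ 3 * (\<Sum>x\<in>A. a x ^ 4)"
proof -
  have "(\<Sum>x\<in>A. a x) ^ 4 = ((\<Sum>x\<in>A. a x)\<^sup>2)\<^sup>2" by (simp flip: power_mult)
  also have "\<dots> \<le> ((\<Sum>x\<in>A. (a x)\<^sup>2) * card A)\<^sup>2"
    by (intro power_mono sum_squared_le_sum_of_squares) simp
  also have "\<dots> = (\<Sum>x\<in>A. (a x)\<^sup>2)\<^sup>2 * (card A)\<^sup>2" by (simp add: power_mult_distrib)
  also have "\<dots> \<le> ((\<Sum>x\<in>A. ((a x)\<^sup>2)\<^sup>2) * card A) * (card A)\<^sup>2"
    by (intro mult_right_mono sum_squared_le_sum_of_squares) simp
  also have "\<dots> = real (card A) ^ 3 * (\<Sum>x\<in>A. a x ^ 4)"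
    by (simp add: power2_eq_square power3_eq_cube power4_eq_xxxx mult_ac)
  finally show ?thesis .
qed

lemma recovery_error_pow4_le:
  assumes "N > 0" "E \<subseteq> ZN_vec N d" "S \<subseteq> ZN_vec N d" "x \<in> ZN_vec N d"
  shows "cmod (indicator E x - recovery_sum N d S (dft N d (indicator E)) x) ^ 4
       \<le> real (card S) ^ 3 * real (additive_energy N d E) / real (N ^ d) ^ 3"
proof -
  let ?F = "dft N d (indicator E)"
  have "indicator E x - recovery_sum N d S ?F x = (\<Sum>m\<in>S. chi N (dot d x m) * ?F m)"
    \<comment> \<open>Writing \<open>indicator E x\<close> as its full Fourier series cancels the
      observed frequencies and leaves only the lost ones.\<close>
    unfolding recovery_sum_def fourier_inversion[OF assms(1,4), of "indicator E", symmetric]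
    using assms(3) by (simp add: sum_diff)
  also have "cmod \<dots> \<le> (\<Sum>m\<in>S. cmod (?F m))"
    by (rule sum_norm_le) (simp add: norm_mult)
  finally have "cmod (indicator E x - recovery_sum N d S ?F x) ^ 4 \<le> (\<Sum>m\<in>S. cmod (?F m)) ^ 4"
    by (intro power_mono) auto
  also have "\<dots> \<le> real (card S) ^ 3 * (\<Sum>m\<in>S. cmod (?F m) ^ 4)"
    by (rule sum_pow4_le_card_pow3)
  also have "\<dots> \<le> real (card S) ^ 3 * (\<Sum>m\<in>ZN_vec N d. cmod (?F m) ^ 4)"
    by (intro mult_left_mono sum_mono2) (use assms(3) in auto)
  also have "\<dots> = real (card S) ^ 3 * real (additive_energy N d E) / real (N ^ d) ^ 3"
    by (simp add: sum_norm_dft_indicator_pow4[OF assms(1,2)])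
  finally show ?thesis .
qed

text \<open>By the reverse triangle inequality the modulus of \<open>z\<close> is also within 1/2 of
  the indicator value; strictness excludes the tie.\<close>

lemma rounds_to_indicator:
  assumes "cmod (indicator E x - z) < 1 / 2"
  shows "rounds_to (cmod z) (indicator E x)"
proof (cases "x \<in> E")
  case True
  then show ?thesis
    using assms norm_triangle_ineq3[of 1 z] by (auto simp: rounds_to_def abs_if split: if_splits)
next
  case False
  then show ?thesis using assms by (auto simp: rounds_to_def)
qed

theorem proposition1p7:
  fixes N d :: nat and E S :: "(nat \<Rightarrow> int) set"
  assumes "N \<ge> 2" and "d \<ge> 1"
    and "E \<subseteq> ZN_vec N d" and "S \<subseteq> ZN_vec N d"
    and "real (card S) * real (additive_energy N d E) powr (1 / 3)
           < real N ^ d / 2 powr (4 / 3)"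
  shows "direct_recoverable N d S E"
proof -
  let ?L = "real (additive_energy N d E)"
  \<comment> \<open>Used for \<open>?L\<close> with \<open>b = 1\<close>, where \<open>a = 0\<close>
    covers empty \<open>E\<close>, and for 2 with \<open>b = 4\<close>, which produces the 16
    below.\<close>
  have cube: "(a powr (b / 3)) ^ 3 = a powr b" if "a \<ge> 0" for a b :: real
    using that by (cases "a = 0") (simp_all add: powr_power)
  have "(real (card S) * ?L powr (1 / 3)) ^ 3 < (real N ^ d / 2 powr (4 / 3)) ^ 3"
    using assms(5) by (intro power_strict_mono) auto
  then have "real (card S) ^ 3 * ?L < real (N ^ d) ^ 3 / 16"
    by (simp add: power_mult_distrib power_divide cube)
  \<comment> \<open>The 1/16 is the fourth power of the rounding threshold 1/2.\<close>
  then have bound: "real (card S) ^ 3 * ?L / real (N ^ d) ^ 3 < (1 / 2) ^ 4"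
    using assms(1) by (simp add: field_simps)
  show ?thesis
    unfolding direct_recoverable_def
  proof
    fix x assume "x \<in> ZN_vec N d"
    then have "cmod (indicator E x - recovery_sum N d S (dft N d (indicator E)) x) ^ 4 < (1 / 2) ^ 4"
      using recovery_error_pow4_le[of N E d S x] assms(1,3,4) bound by simp
    then have "cmod (indicator E x - recovery_sum N d S (dft N d (indicator E)) x) < 1 / 2"
      by (rule power_less_imp_less_base) simp
    then show "rounds_to (cmod (recovery_sum N d S (dft N d (indicator E)) x)) (indicator E x)"
      by (rule rounds_to_indicator)
  qed
qed

end
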